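(* Let $C_1$ and $C_2$ be proper open convex cones in finite-dimensional real vector spaces $V_1$ and $V_2$, respectively. If there exists a gauge-reversing bijection $\phi\colon C_1\to C_2$, then $C_1$ and $C_2$ are linearly isomorphic, that is, there is a linear isomorphism $A\colon V_1\to V_2$ with $A(C_1)=C_2$.
   Context: A proper open convex cone $C$ in a real vector space $V$ is a non-empty open convex set, invariant under multiplication by positive scalars, with $\overline{C}\cap(-\overline{C})=\{0\}$. Write $x\le_C y$ if $y-x\in\overline{C}$. The gauge on $C$ is $M_C(x,y):=\inf\{\lambda>0 \mid x\le_C\lambda y\}$ for $x,y\in C$. A map $\phi\colon C_1\to C_2$ is gauge-reversing if $M_{C_2}(\phi(x),\phi(y))=M_{C_1}(y,x)$ for all $x,y\in C_1$. *)

theory Defs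
  imports "HOL-Analysis.Analysis"
begin

text \<open>
  The library predicates \<open>cone\<close> and \<open>conic\<close> are not used: they require closure under
  multiplication by 0 as well, which a proper open cone does not have in positive dimension.
  The norm is only there for \<open>open\<close> and \<open>closure\<close>: in finite dimension every norm induces
  the standard topology.
\<close>

definition proper_open_convex_cone :: "'a::real_normed_vector set \<Rightarrow> bool" where
  "proper_open_convex_cone C \<longleftrightarrow>
     C \<noteq> {} \<and> open C \<and> convex C \<and> (\<forall>x\<in>C. \<forall>t>0. t *\<^sub>R x \<in> C) \<and>
     closure C \<inter> uminus ` closure C = {0}"

definition cone_le :: "'a::real_normed_vector set \<Rightarrow> 'a \<Rightarrow> 'a \<Rightarrow> bool" where
  "cone_le C x y \<longleftrightarrow> y - x \<in> closure C"

text \<open>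
  For \<open>x\<close> and \<open>y\<close> in an open cone \<open>C\<close> the set below is nonempty and bounded below by 0, so
  the infimum in the reals is the true one. Outside \<open>C\<close> the value is not meaningful.
\<close>

definition cone_gauge :: "'a::real_normed_vector set \<Rightarrow> 'a \<Rightarrow> 'a \<Rightarrow> real" where
  "cone_gauge C x y = Inf {l. l > 0 \<and> cone_le C x (l *\<^sub>R y)}"

text \<open>A map on \<open>C1\<close> is a total function of which only the values on \<open>C1\<close> matter.\<close>

definition gauge_reversing ::
  "'a::real_normed_vector set \<Rightarrow> 'b::real_normed_vector set \<Rightarrow> ('a \<Rightarrow> 'b) \<Rightarrow> bool" where
  "gauge_reversing C1 C2 \<phi> \<longleftrightarrow>
     \<phi> \<in> C1 \<rightarrow> C2 \<and> (\<forall>x\<in>C1. \<forall>y\<in>C1. cone_gauge C2 (\<phi> x) (\<phi> y) = cone_gauge C1 y x)"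

end

theory Submission imports Defs begin

text \<open>
  A gauge-reversing map is an order-reversing map, homogeneous of degree \<open>-1\<close>. If such a map \<open>\<phi>\<close>
  is differentiable at one point \<open>x\<close>, then \<open>- D\<phi>(x)\<close> preserves and reflects the orders of the two
  cones. To find \<open>x\<close>, note that \<open>y \<mapsto> M(p, y)\<close> is convex because \<open>t \<mapsto> 1 / t\<close> is, so every
  \<open>y \<mapsto> M(\<phi> y, q)\<close> is convex; letting \<open>q\<close> tend to a boundary point exposing a functional \<open>g\<close>, and
  rescaling, shows that \<open>g \<circ> \<phi>\<close> is convex for every exposed functional \<open>g\<close> of the dual cone. These
  functionals span the dual space. Finitely many convex functions have a common point of
  differentiability: their sum is touched from above by a paraboloid somewhere.
\<close>

section \<open>Proper cones and order-reversing maps\<close>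

lemma proper_open_convex_coneD:
  assumes "proper_open_convex_cone C"
  shows "C \<noteq> {}" "open C" "convex C" "\<And>x t. x \<in> C \<Longrightarrow> t > 0 \<Longrightarrow> t *\<^sub>R x \<in> C"
    "\<And>x. x \<in> closure C \<Longrightarrow> - x \<in> closure C \<Longrightarrow> x = 0" "0 \<in> closure C"
proof -
  show "C \<noteq> {}" "open C" "convex C" "\<And>x t. x \<in> C \<Longrightarrow> t > 0 \<Longrightarrow> t *\<^sub>R x \<in> C"
    using assms by (auto simp: proper_open_convex_cone_def)
  have eq: "closure C \<inter> uminus ` closure C = {0}"
    using assms by (simp add: proper_open_convex_cone_def)
  then show "0 \<in> closure C" by blast
  show "x = 0" if "x \<in> closure C" "- x \<in> closure C" for x
  proof -
    have "x = - (- x)" by simp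
    then have "x \<in> uminus ` closure C" using that(2) by blast
    then show ?thesis using that(1) eq by blast
  qed
qed

lemma closure_cone_scaleR:
  assumes "proper_open_convex_cone C" "x \<in> closure C" "t \<ge> 0"
  shows "t *\<^sub>R x \<in> closure C"
proof (cases "t = 0")
  case True
  then show ?thesis using proper_open_convex_coneD(6)[OF assms(1)] by simp
next
  case False
  then have "(*\<^sub>R) t ` C \<subseteq> C"
    using assms(3) proper_open_convex_coneD(4)[OF assms(1)] by auto
  then show ?thesis
    using closure_scaleR[of t C] assms(2) closure_mono by blast
qed

lemma closure_cone_add:
  assumes "proper_open_convex_cone C" "x \<in> closure C" "y \<in> closure C"
  shows "x + y \<in> closure C"
proof -
  have "convex (closure C)"
    by (rule convex_closure[OF proper_open_convex_coneD(3)[OF assms(1)]])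
  then have "(1/2) *\<^sub>R x + (1/2) *\<^sub>R y \<in> closure C"
    using assms by (auto elim!: convexD)
  from closure_cone_scaleR[OF assms(1) this, of 2] show ?thesis
    by (simp add: scaleR_add_right)
qed

text \<open>A point \<open>x'\<close> of \<open>C\<close> close to \<open>x\<close> replaces it, and
  the error \<open>x - x'\<close> is moved to \<open>y\<close>, where a ball inside \<open>C\<close>
  absorbs it.\<close>

lemma closure_cone_add_interior:
  assumes "proper_open_convex_cone C" "x \<in> closure C" "y \<in> C"
  shows "x + y \<in> C"
proof -
  note C = proper_open_convex_coneD[OF assms(1)]
  obtain r where r: "r > 0" "ball y r \<subseteq> C"
    using C(2) assms(3) openE by blast
  obtain x' where x': "x' \<in> C" "dist x' x < r"
    using assms(2) r(1) closure_approachable by blast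
  have "y + (x - x') \<in> C"
    using x'(2) r(2) by (auto simp: dist_norm subset_iff norm_minus_commute)
  then have "(1/2) *\<^sub>R x' + (1/2) *\<^sub>R (y + (x - x')) \<in> C"
    using x'(1) C(3) by (auto elim!: convexD)
  from C(4)[OF this, of 2] show ?thesis
    by (simp add: algebra_simps)
qed

text \<open>The admissible factors form an up-set, and closedness of \<open>closure C\<close> adds
  every positive limit from above. All later arguments reach the gauge through this
  equivalence.\<close>

lemma cone_gauge_le_iff:
  assumes "proper_open_convex_cone C" "x \<in> C" "y \<in> C" "l > 0"
  shows "cone_gauge C x y \<le> l \<longleftrightarrow> l *\<^sub>R y - x \<in> closure C"
proof -
  note C = proper_open_convex_coneD[OF assms(1)]
  define S where "S = {l. l > 0 \<and> l *\<^sub>R y - x \<in> closure C}"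
  have gauge: "cone_gauge C x y = Inf S"
    by (simp add: cone_gauge_def cone_le_def S_def)
  have bdd: "bdd_below S"
    by (rule bdd_belowI[of _ 0]) (simp add: S_def)
  have up: "m \<in> S" if "k \<in> S" "k \<le> m" for k m
  proof -
    have "(k *\<^sub>R y - x) + (m - k) *\<^sub>R y \<in> closure C"
      using that assms(3) by (intro closure_cone_add[OF assms(1)] closure_cone_scaleR[OF assms(1)])
        (auto simp: S_def closure_def)
    then show ?thesis using that by (auto simp: S_def algebra_simps)
  qed
  have ne: "S \<noteq> {}"
  proof -
    obtain r where r: "r > 0" "ball y r \<subseteq> C"
      using C(2) assms(3) openE by blast
    \<comment> \<open>Since \<open>y\<close> is interior, it stays in \<open>C\<close> after
      subtracting a short multiple of \<open>x\<close>, which makes \<open>1/t\<close> admissible.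
      The summand 1 covers \<open>x = 0\<close>.\<close>
    define t where "t = r / (2 * (norm x + 1))"
    have t: "t > 0" using r(1) by (simp add: t_def add_nonneg_pos)
    have "norm (t *\<^sub>R x) < r"
    proof -
      have "norm (t *\<^sub>R x) = r / 2 * (norm x / (norm x + 1))"
        using t r(1) by (simp add: t_def abs_mult)
      also have "\<dots> \<le> r / 2 * 1"
        using r(1) norm_ge_zero[of x] by (intro mult_left_mono) (auto simp: divide_simps simp del: norm_ge_zero)
      finally show ?thesis using r(1) by simp
    qed
    then have "y - t *\<^sub>R x \<in> C" using r(2) by (auto simp: dist_norm subset_iff)
    then have "(1/t) *\<^sub>R (y - t *\<^sub>R x) \<in> C" using C(4) t by simp
    then have "1/t \<in> S" using t closure_subset by (auto simp: S_def algebra_simps)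
    then show ?thesis by blast
  qed
  show ?thesis
  proof
    assume "l *\<^sub>R y - x \<in> closure C"
    then have "l \<in> S" using assms(4) by (simp add: S_def)
    then show "cone_gauge C x y \<le> l" using bdd by (simp add: gauge cInf_lower)
  next
    assume le: "cone_gauge C x y \<le> l"
    have "(l + inverse (real (Suc n))) *\<^sub>R y - x \<in> closure C" for n
    proof -
      have "Inf S < l + inverse (real (Suc n))"
        using le by (simp add: gauge add_strict_increasing2 le_less_trans)
      then obtain k where "k \<in> S" "k < l + inverse (real (Suc n))"
        using ne bdd cInf_less_iff by blast
      then show ?thesis using up[of k "l + inverse (real (Suc n))"] by (simp add: S_def)
    qed
    moreover have "(\<lambda>n. (l + inverse (real (Suc n))) *\<^sub>R y - x) \<longlonglongrightarrow> (l + 0) *\<^sub>R y - x"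
      by (intro tendsto_intros LIMSEQ_inverse_real_of_nat)
    ultimately show "l *\<^sub>R y - x \<in> closure C"
      using closed_sequentially[OF closed_closure] by fastforce
  qed
qed

text \<open>The gauge identity, tested against every bound \<open>l > 0\<close> and written as
  membership in closed cones. Without infima it passes easily to inverses and through linear
  coordinate changes. The case \<open>l = 1\<close> is order reversal; the other \<open>l\<close>
  encode homogeneity of degree -1.\<close>

definition order_reversing where
  "order_reversing C1 C2 \<phi> \<longleftrightarrow> \<phi> \<in> C1 \<rightarrow> C2 \<and>
    (\<forall>x\<in>C1. \<forall>y\<in>C1. \<forall>l>0. l *\<^sub>R \<phi> y - \<phi> x \<in> closure C2 \<longleftrightarrow> l *\<^sub>R x - y \<in> closure C1)"

lemma gauge_reversing_imp_order_reversing: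
  assumes "proper_open_convex_cone C1" "proper_open_convex_cone C2" "gauge_reversing C1 C2 \<phi>"
  shows "order_reversing C1 C2 \<phi>"
  unfolding order_reversing_def
proof (intro conjI ballI allI impI)
  show \<phi>: "\<phi> \<in> C1 \<rightarrow> C2" using assms(3) by (simp add: gauge_reversing_def)
  fix x y and l :: real assume "x \<in> C1" "y \<in> C1" "l > 0"
  then show "l *\<^sub>R \<phi> y - \<phi> x \<in> closure C2 \<longleftrightarrow> l *\<^sub>R x - y \<in> closure C1"
    using assms \<phi> cone_gauge_le_iff[of C2 "\<phi> x" "\<phi> y" l] cone_gauge_le_iff[of C1 y x l]
    by (auto simp: gauge_reversing_def)
qed

lemma order_reversing_iff:
  assumes "order_reversing C1 C2 \<phi>" "x \<in> C1" "y \<in> C1" "l > 0"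
  shows "l *\<^sub>R \<phi> y - \<phi> x \<in> closure C2 \<longleftrightarrow> l *\<^sub>R x - y \<in> closure C1"
  using assms by (simp add: order_reversing_def)

lemma order_reversing_mem: "order_reversing C1 C2 \<phi> \<Longrightarrow> x \<in> C1 \<Longrightarrow> \<phi> x \<in> C2"
  by (auto simp: order_reversing_def)

lemma order_reversing_inv_into:
  assumes "order_reversing C1 C2 \<phi>" "bij_betw \<phi> C1 C2"
  shows "order_reversing C2 C1 (inv_into C1 \<phi>)"
proof -
  have inv: "inv_into C1 \<phi> y \<in> C1" "\<phi> (inv_into C1 \<phi> y) = y" if "y \<in> C2" for y
    using assms(2) that by (auto simp: bij_betw_def inv_into_into f_inv_into_f)
  show ?thesis
    unfolding order_reversing_def
  proof (intro conjI ballI allI impI)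
    show "inv_into C1 \<phi> \<in> C2 \<rightarrow> C1" using inv(1) by blast
    fix x y and l :: real assume "x \<in> C2" "y \<in> C2" "l > 0"
    then show "l *\<^sub>R inv_into C1 \<phi> y - inv_into C1 \<phi> x \<in> closure C1 \<longleftrightarrow> l *\<^sub>R x - y \<in> closure C2"
      using order_reversing_iff[OF assms(1), of "inv_into C1 \<phi> y" "inv_into C1 \<phi> x" l] inv by simp
  qed
qed

text \<open>Comparing \<open>x\<close> with \<open>t *\<^sub>R x\<close> at the factors
  \<open>1/t\<close> and \<open>t\<close> reduces both inequalities to 0 lying in the closed cone;
  properness then gives equality.\<close>

lemma order_reversing_scaleR:
  assumes "proper_open_convex_cone C1" "proper_open_convex_cone C2"
    "order_reversing C1 C2 \<phi>" "x \<in> C1" "t > 0"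
  shows "\<phi> (t *\<^sub>R x) = (1/t) *\<^sub>R \<phi> x"
proof -
  note C1 = proper_open_convex_coneD[OF assms(1)] and C2 = proper_open_convex_coneD[OF assms(2)]
  have tx: "t *\<^sub>R x \<in> C1" using C1(4) assms by blast
  have "(1/t) *\<^sub>R \<phi> x - \<phi> (t *\<^sub>R x) \<in> closure C2"
    using order_reversing_iff[OF assms(3) tx assms(4), of "1/t"] C1(6) assms(5) by simp
  moreover have "t *\<^sub>R \<phi> (t *\<^sub>R x) - \<phi> x \<in> closure C2"
    using order_reversing_iff[OF assms(3) assms(4) tx, of t] C1(6) assms(5) by simp
  then have "(1/t) *\<^sub>R (t *\<^sub>R \<phi> (t *\<^sub>R x) - \<phi> x) \<in> closure C2"
    using assms by (intro closure_cone_scaleR) auto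
  then have "- ((1/t) *\<^sub>R \<phi> x - \<phi> (t *\<^sub>R x)) \<in> closure C2"
    using assms(5) by (simp add: algebra_simps)
  ultimately have "(1/t) *\<^sub>R \<phi> x - \<phi> (t *\<^sub>R x) = 0" by (rule C2(5))
  then show ?thesis by simp
qed

text \<open>\<open>z\<close> records that the space is nonzero: in the zero space \<open>{0}\<close>
  is a proper open convex cone. If 0 were in \<open>C\<close>, a ball about it would contain a
  nonzero multiple of \<open>z\<close> and its negative.\<close>

lemma zero_notin_cone:
  fixes C :: "'a::real_normed_vector set"
  assumes "proper_open_convex_cone C" "z \<noteq> (0::'a)"
  shows "0 \<notin> C"
proof
  assume "0 \<in> C"
  then obtain r where r: "r > 0" "ball 0 r \<subseteq> C"
    using proper_open_convex_coneD(2)[OF assms(1)] openE by blast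
  define t where "t = r / (2 * norm z)"
  have t: "t > 0" using r assms(2) by (simp add: t_def)
  then have nt: "norm (t *\<^sub>R z) < r" using r assms(2) by (simp add: t_def)
  then have "t *\<^sub>R z \<in> C" "- (t *\<^sub>R z) \<in> C"
    using r(2) by (auto simp: subset_iff)
  then have "t *\<^sub>R z \<in> closure C" "- (t *\<^sub>R z) \<in> closure C"
    using closure_subset[of C] by blast+
  then have "t *\<^sub>R z = 0" by (rule proper_open_convex_coneD(5)[OF assms(1)])
  then show False using t assms(2) by simp
qed

section \<open>Exposed functionals of the dual cone\<close>

text \<open>Functionals are represented through the inner product. For \<open>e\<close> in
  \<open>C\<close>, the normalisation at \<open>e\<close> cuts the dual cone in a compact
  base.\<close>

definition dual_base :: "'a::real_inner set \<Rightarrow> 'a \<Rightarrow> 'a set" where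
  "dual_base C e = {g. g \<bullet> e = 1 \<and> (\<forall>y\<in>C. 0 \<le> g \<bullet> y)}"

lemma dual_base_nonneg:
  assumes "g \<in> dual_base C e" "y \<in> closure C"
  shows "0 \<le> g \<bullet> y"
proof -
  have "closed {y. 0 \<le> g \<bullet> y}" by (intro closed_Collect_le continuous_intros)
  then have "closure C \<subseteq> {y. 0 \<le> g \<bullet> y}"
    using assms(1) by (intro closure_minimal) (auto simp: dual_base_def)
  then show ?thesis using assms(2) by auto
qed

text \<open>For boundedness, a step of length \<open>r\<close> from \<open>e\<close> against
  \<open>g\<close> stays in \<open>C\<close> and lowers the value 1 by \<open>r * norm g\<close>,
  and the result must be nonnegative.\<close>

lemma compact_dual_base:
  fixes C :: "'a::euclidean_space set"
  assumes "proper_open_convex_cone C" "e \<in> C"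
  shows "compact (dual_base C e)"
  unfolding compact_eq_bounded_closed
proof
  have "dual_base C e = {g. g \<bullet> e = 1} \<inter> (\<Inter>y\<in>C. {g. 0 \<le> g \<bullet> y})"
    by (auto simp: dual_base_def)
  then show "closed (dual_base C e)"
    by (auto intro!: closed_Int closed_INT closed_Collect_eq closed_Collect_le continuous_intros)
  obtain r where r: "r > 0" "cball e r \<subseteq> C"
    using proper_open_convex_coneD(2)[OF assms(1)] assms(2) open_contains_cball by blast
  have "norm g \<le> 1 / r" if g: "g \<in> dual_base C e" for g
  proof (cases "g = 0")
    case False
    have "e - (r / norm g) *\<^sub>R g \<in> C"
      using r False by (auto simp: subset_iff dist_norm)
    then have "0 \<le> g \<bullet> (e - (r / norm g) *\<^sub>R g)" using g by (simp add: dual_base_def)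
    also have "\<dots> = 1 - r * norm g"
      using g False by (simp add: dual_base_def inner_diff_right dot_square_norm power2_eq_square)
    finally show ?thesis using r by (simp add: field_simps)
  qed (use r in simp)
  then show "bounded (dual_base C e)" by (auto simp: bounded_iff)
qed

text \<open>A functional separating \<open>y\<close> from the closed cone is nonnegative on the cone
  by scaling and positive at \<open>e\<close> because \<open>e\<close> is interior. It can therefore
  be normalised to a member of the base that is negative at \<open>y\<close>.\<close>

lemma bipolar:
  fixes C :: "'a::euclidean_space set"
  assumes "proper_open_convex_cone C" "e \<in> C" and nonneg: "\<And>g. g \<in> dual_base C e \<Longrightarrow> 0 \<le> g \<bullet> y"
  shows "y \<in> closure C"
proof (rule ccontr)
  assume "y \<notin> closure C"
  note C = proper_open_convex_coneD[OF assms(1)]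
  obtain a b where ab: "a \<bullet> y < b" "\<And>x. x \<in> closure C \<Longrightarrow> a \<bullet> x > b"
    using separating_hyperplane_closed_point[OF convex_closure[OF C(3)] closed_closure \<open>y \<notin> closure C\<close>]
    by blast
  have b: "b < 0" using ab(2)[OF C(6)] by simp
  have a: "0 \<le> a \<bullet> x" if "x \<in> closure C" for x
  proof (rule ccontr)
    assume neg: "\<not> 0 \<le> a \<bullet> x"
    \<comment> \<open>This multiple of \<open>x\<close> lies on the separating hyperplane, which the
      closed cone does not meet.\<close>
    then have "(b / (a \<bullet> x)) *\<^sub>R x \<in> closure C"
      using b that by (intro closure_cone_scaleR[OF assms(1)]) (auto simp: divide_nonpos_nonpos)
    from ab(2)[OF this] show False using neg by simp
  qed
  have "a \<noteq> 0" using ab(1) b by auto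
  obtain r where r: "r > 0" "ball e r \<subseteq> C"
    using C(2) assms(2) openE by blast
  define t where "t = r / (2 * norm a)"
  have "t > 0" using r \<open>a \<noteq> 0\<close> by (simp add: t_def)
  have "e - t *\<^sub>R a \<in> C"
    using r \<open>a \<noteq> 0\<close> by (auto simp: subset_iff dist_norm t_def)
  then have "0 \<le> a \<bullet> (e - t *\<^sub>R a)" using a closure_subset by blast
  moreover have "0 < t * (a \<bullet> a)" using \<open>t > 0\<close> \<open>a \<noteq> 0\<close> by simp
  ultimately have ae: "0 < a \<bullet> e" by (simp add: inner_diff_right)
  have "(1 / (a \<bullet> e)) *\<^sub>R a \<in> dual_base C e"
    using ae a closure_subset[of C] by (auto simp: dual_base_def)
  from nonneg[OF this] have "0 \<le> a \<bullet> y" using ae by (simp add: zero_le_divide_iff)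
  then show False using ab(1) b by simp
qed

text \<open>
  A point of \<open>dual_base C e\<close> at maximal distance from some centre \<open>c\<close> is exposed, by the functional
  \<open>g - c\<close>, with a quadratic modulus.
\<close>

definition farthest_dual :: "'a::real_inner set \<Rightarrow> 'a \<Rightarrow> 'a set" where
  "farthest_dual C e = {g \<in> dual_base C e. \<exists>c. \<forall>k\<in>dual_base C e. dist c k \<le> dist c g}"

text \<open>A nonzero \<open>w\<close> orthogonal to all these functionals is still detected by some
  \<open>k\<close> of the base, since the closed cone contains no line. But a base point farthest
  from a centre far out along \<open>- u\<close> cannot be orthogonal to \<open>u\<close>.\<close>

lemma span_farthest_dual:
  fixes C :: "'a::euclidean_space set"
  assumes "proper_open_convex_cone C" "e \<in> C"
  shows "span (farthest_dual C e) = UNIV"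
proof (rule ccontr)
  assume "span (farthest_dual C e) \<noteq> UNIV"
  then obtain w where w: "w \<noteq> 0" "\<forall>g\<in>span (farthest_dual C e). w \<bullet> g = 0"
    using span_not_UNIV_orthogonal by blast
  let ?K = "dual_base C e"
  note K = compact_dual_base[OF assms]
  obtain k where k: "k \<in> ?K" "k \<bullet> w \<noteq> 0"
  proof -
    have "\<not> (w \<in> closure C \<and> - w \<in> closure C)"
      using proper_open_convex_coneD(5)[OF assms(1)] w(1) by blast
    then show ?thesis using bipolar[OF assms, of w] bipolar[OF assms, of "- w"] that by fastforce
  qed
  define u where "u = (if k \<bullet> w > 0 then w else - w)"
  have u: "k \<bullet> u > 0" "\<And>g. g \<in> farthest_dual C e \<Longrightarrow> g \<bullet> u = 0"
    using k(2) w(2) by (auto simp: u_def inner_commute span_base)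
  obtain R where R: "\<And>g. g \<in> ?K \<Longrightarrow> norm g \<le> R"
    using compact_imp_bounded[OF K] by (auto simp: bounded_iff)
  \<comment> \<open>With this \<open>t\<close>, \<open>2 * t * (k \<bullet> u)\<close> exceeds
    \<open>R\<^sup>2\<close>, a bound for the squared norm of \<open>g\<close>, so \<open>k\<close>
    would be farther from the centre than \<open>g\<close>.\<close>
  define t where "t = (R\<^sup>2 + 1) / (2 * (k \<bullet> u))"
  obtain g where g: "g \<in> ?K" "\<And>h. h \<in> ?K \<Longrightarrow> dist (- t *\<^sub>R u) h \<le> dist (- t *\<^sub>R u) g"
    using distance_attains_sup[OF K, of "- t *\<^sub>R u"] k(1) by blast
  have "g \<in> farthest_dual C e" using g by (auto simp: farthest_dual_def)
  then have gu: "g \<bullet> u = 0" by (rule u(2))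
  have d: "(dist (- t *\<^sub>R u) h)\<^sup>2 = (norm h)\<^sup>2 + 2 * t * (h \<bullet> u) + t\<^sup>2 * (norm u)\<^sup>2" for h
    unfolding dist_norm power2_norm_eq_inner
    by (simp add: inner_diff_left inner_diff_right inner_commute power2_eq_square algebra_simps)
  have "(dist (- t *\<^sub>R u) k)\<^sup>2 \<le> (dist (- t *\<^sub>R u) g)\<^sup>2"
    using g(2)[OF k(1)] by (intro power_mono) auto
  then have "2 * t * (k \<bullet> u) + (norm k)\<^sup>2 \<le> (norm g)\<^sup>2" unfolding d by (simp add: gu)
  also have "\<dots> \<le> R\<^sup>2" using R[OF g(1)] by (intro power_mono) auto
  moreover have "2 * t * (k \<bullet> u) = R\<^sup>2 + 1" using u(1) by (simp add: t_def)
  ultimately show False using zero_le_power2[of "norm k"] by linarith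
qed

text \<open>
  The point \<open>q\<close> approaches, as \<open>\<delta>\<close> tends to 0, a boundary point of the cone on which \<open>g\<close> is the only
  vanishing functional of the base; the last clause bounds the gauge of \<open>y\<close> relative to \<open>q\<close>.
\<close>

lemma exposed_approx:
  fixes C :: "'a::euclidean_space set"
  assumes "proper_open_convex_cone C" "e \<in> C" "g \<in> farthest_dual C e" "\<delta> > 0"
  obtains q where "q \<in> C" "g \<bullet> q = 2 * \<delta>\<^sup>2"
    "\<And>y. y \<in> C \<Longrightarrow> ((g \<bullet> y + \<delta> * norm y) / (2 * \<delta>\<^sup>2)) *\<^sub>R q - y \<in> closure C"
proof -
  obtain c where gK: "g \<in> dual_base C e" and c: "\<And>k. k \<in> dual_base C e \<Longrightarrow> dist c k \<le> dist c g"
    using assms(3) by (auto simp: farthest_dual_def)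
  have ge: "g \<bullet> e = 1" using gK by (simp add: dual_base_def)
  \<comment> \<open>On the base, \<open>q0\<close> acts as
    \<open>k \<mapsto> (c - g) \<bullet> (k - g)\<close>: the multiple of \<open>e\<close> makes it
    vanish at \<open>g\<close>. Expanding the squared distances from \<open>c\<close> shows that it
    grows at least like half the squared distance from \<open>g\<close>.\<close>
  define q0 where "q0 = (c - g) - ((c - g) \<bullet> g) *\<^sub>R e"
  have q0: "(norm (k - g))\<^sup>2 / 2 \<le> k \<bullet> q0" if k: "k \<in> dual_base C e" for k
  proof -
    have ke: "k \<bullet> e = 1" using k by (simp add: dual_base_def)
    have "(dist c k)\<^sup>2 \<le> (dist c g)\<^sup>2" using c[OF k] by (intro power_mono) auto
    moreover have "(dist c k)\<^sup>2 = (dist c g)\<^sup>2 - 2 * ((c - g) \<bullet> (k - g)) + (norm (k - g))\<^sup>2"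
      unfolding dist_norm power2_norm_eq_inner
      by (simp add: inner_diff_left inner_diff_right inner_commute)
    moreover have "k \<bullet> q0 = (c - g) \<bullet> (k - g)"
      by (simp add: q0_def inner_diff_right ke) (simp add: inner_commute inner_diff_right)
    ultimately show ?thesis by simp
  qed
  have "q0 \<in> closure C"
  proof (rule bipolar[OF assms(1,2)])
    fix k assume "k \<in> dual_base C e"
    from q0[OF this] show "0 \<le> k \<bullet> q0" using zero_le_power2[of "norm (k - g)"] by linarith
  qed
  \<comment> \<open>The multiple of \<open>e\<close> moves \<open>q0\<close> from the closed cone
    into \<open>C\<close> and raises the value of every member of the base by
    \<open>2 * \<delta>\<^sup>2\<close>.\<close>
  define q where "q = q0 + (2 * \<delta>\<^sup>2) *\<^sub>R e"
  have "q \<in> C"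
    unfolding q_def using assms \<open>q0 \<in> closure C\<close> proper_open_convex_coneD(4)[OF assms(1,2)]
    by (intro closure_cone_add_interior) auto
  moreover have "g \<bullet> q = 2 * \<delta>\<^sup>2"
    by (simp add: q_def q0_def ge inner_add_right inner_diff_right inner_diff_left) (simp add: inner_commute)
  moreover have "((g \<bullet> y + \<delta> * norm y) / (2 * \<delta>\<^sup>2)) *\<^sub>R q - y \<in> closure C" if y: "y \<in> C" for y
  proof (rule bipolar[OF assms(1,2)])
    fix k assume k: "k \<in> dual_base C e"
    define s where "s = norm (k - g)"
    have ke: "k \<bullet> e = 1" using k by (simp add: dual_base_def)
    have gy: "0 \<le> g \<bullet> y" using gK y by (simp add: dual_base_def)
    \<comment> \<open>This is the inequality of arithmetic and geometric means. It lets the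
      quadratic growth of \<open>k \<bullet> q\<close> dominate the linear error
      \<open>s * norm y\<close> made in replacing \<open>k \<bullet> y\<close> by
      \<open>g \<bullet> y\<close>.\<close>
    have "s \<le> \<delta> * ((s\<^sup>2 / 2 + 2 * \<delta>\<^sup>2) / (2 * \<delta>\<^sup>2))"
    proof -
      have "0 \<le> (s - 2 * \<delta>)\<^sup>2" by simp
      then have "s * (4 * \<delta>) \<le> s\<^sup>2 + 4 * \<delta>\<^sup>2" by (simp add: power2_eq_square algebra_simps)
      then have "s \<le> (s\<^sup>2 + 4 * \<delta>\<^sup>2) / (4 * \<delta>)" using assms(4) by (simp add: pos_le_divide_eq)
      also have "\<dots> = \<delta> * ((s\<^sup>2 / 2 + 2 * \<delta>\<^sup>2) / (2 * \<delta>\<^sup>2))"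
        using assms(4) by (simp add: field_simps power2_eq_square)
      finally show ?thesis .
    qed
    from mult_right_mono[OF this norm_ge_zero[of y]]
    have 1: "s * norm y \<le> \<delta> * norm y / (2 * \<delta>\<^sup>2) * (s\<^sup>2 / 2 + 2 * \<delta>\<^sup>2)" by (simp add: ac_simps)
    have 2: "(g \<bullet> y) * 1 \<le> (g \<bullet> y) * ((s\<^sup>2 / 2 + 2 * \<delta>\<^sup>2) / (2 * \<delta>\<^sup>2))"
      using gy assms(4) by (intro mult_left_mono) (auto simp: field_simps)
    have "g \<bullet> y + s * norm y \<le> (g \<bullet> y + \<delta> * norm y) / (2 * \<delta>\<^sup>2) * (s\<^sup>2 / 2 + 2 * \<delta>\<^sup>2)"
      using add_mono[OF 2 1] by (simp only: mult_1_right add_divide_distrib[of "g \<bullet> y"] distrib_right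
          times_divide_eq_left times_divide_eq_right)
    also have "\<dots> \<le> (g \<bullet> y + \<delta> * norm y) / (2 * \<delta>\<^sup>2) * (k \<bullet> q)"
      using q0[OF k] gy assms(4) by (intro mult_left_mono) (auto simp: q_def s_def inner_add_right ke)
    finally have "g \<bullet> y + s * norm y \<le> (g \<bullet> y + \<delta> * norm y) / (2 * \<delta>\<^sup>2) * (k \<bullet> q)" .
    moreover have "(k - g) \<bullet> y \<le> s * norm y" unfolding s_def by (rule norm_cauchy_schwarz)
    ultimately show "0 \<le> k \<bullet> (((g \<bullet> y + \<delta> * norm y) / (2 * \<delta>\<^sup>2)) *\<^sub>R q - y)"
      by (simp add: inner_diff_left inner_diff_right)
  qed
  ultimately show ?thesis by (rule that)
qed

text \<open>If \<open>\<phi> p = q\<close>, bounding \<open>\<phi> v\<close> by a multiple of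
  \<open>q\<close> amounts to bounding \<open>p\<close> by the same multiple of \<open>v\<close>,
  and such bounds can be averaged over \<open>v\<close>. With \<open>q\<close> from
  \<open>exposed_approx\<close>, the multiples times \<open>2 * \<delta>\<^sup>2\<close> are
  \<open>g \<bullet> \<phi> v\<close> up to an error of order \<delta>.\<close>

lemma convex_on_exposed_comp:
  fixes C2 :: "'b::euclidean_space set"
  assumes C1: "proper_open_convex_cone C1" and C2: "proper_open_convex_cone C2"
    and \<phi>: "order_reversing C1 C2 \<phi>" "bij_betw \<phi> C1 C2"
    and e: "e \<in> C2" and g: "g \<in> farthest_dual C2 e"
  shows "convex_on C1 (\<lambda>x. g \<bullet> \<phi> x)"
proof (rule convex_onI)
  show "convex C1" by (rule proper_open_convex_coneD(3)[OF C1])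
  fix t x y assume t: "0 < t" "t < (1::real)" and x: "x \<in> C1" and y: "y \<in> C1"
  define z where "z = (1 - t) *\<^sub>R x + t *\<^sub>R y"
  have z: "z \<in> C1"
    unfolding z_def using t x y proper_open_convex_coneD(3)[OF C1] by (auto elim!: convexD)
  \<comment> \<open>Nonvanishing on \<open>C2\<close> makes the norm term in \<open>l\<close> below
    strictly positive.\<close>
  obtain w :: 'b where "w \<noteq> 0" using nonzero_Basis SOME_Basis by blast
  then have nz: "v \<noteq> 0" if "v \<in> C2" for v using zero_notin_cone[OF C2] that by blast
  have gC: "0 \<le> g \<bullet> v" if "v \<in> closure C2" for v
    using dual_base_nonneg that g by (auto simp: farthest_dual_def)
  have bound: "g \<bullet> \<phi> z \<le> (1 - t) * (g \<bullet> \<phi> x + \<delta> * norm (\<phi> x)) + t * (g \<bullet> \<phi> y + \<delta> * norm (\<phi> y))"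
    if \<delta>: "\<delta> > 0" for \<delta>
  proof -
    obtain q where q: "q \<in> C2" "g \<bullet> q = 2 * \<delta>\<^sup>2"
      "\<And>y. y \<in> C2 \<Longrightarrow> ((g \<bullet> y + \<delta> * norm y) / (2 * \<delta>\<^sup>2)) *\<^sub>R q - y \<in> closure C2"
      using exposed_approx[OF C2 e g \<delta>] by metis
    obtain p where p: "p \<in> C1" "\<phi> p = q" using \<phi>(2) q(1) by (auto simp: bij_betw_def)
    define l where "l v = (g \<bullet> \<phi> v + \<delta> * norm (\<phi> v)) / (2 * \<delta>\<^sup>2)" for v
    have l: "l v > 0" "l v *\<^sub>R v - p \<in> closure C1" if v: "v \<in> C1" for v
    proof -
      have \<phi>v: "\<phi> v \<in> C2" by (rule order_reversing_mem[OF \<phi>(1) v])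
      then show "l v > 0"
        using \<delta> nz gC closure_subset by (auto simp: l_def intro!: divide_pos_pos add_nonneg_pos)
      then show "l v *\<^sub>R v - p \<in> closure C1"
        using q(3)[OF \<phi>v] order_reversing_iff[OF \<phi>(1) v p(1)] by (simp add: l_def p(2))
    qed
    define n where "n = (1 - t) * l x + t * l y"
    have n: "n > 0" using t l(1) x y by (simp add: n_def add_pos_pos)
    \<comment> \<open>\<open>k \<ge> 0\<close> is the weighted inequality between the arithmetic and
      harmonic means of \<open>l x\<close> and \<open>l y\<close>, that is, convexity of
      \<open>t \<mapsto> 1 / t\<close>.\<close>
    define k where "k = n * ((1 - t) / l x + t / l y) - 1"
    have k: "k \<ge> 0"
    proof -
      have "l x * l y * (k + 1) = n * ((1 - t) * l y + t * l x)"
        using l(1)[OF x] l(1)[OF y] by (simp add: k_def field_simps)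
      also have "\<dots> = l x * l y + t * (1 - t) * (l x - l y)\<^sup>2"
        by (simp add: n_def power2_eq_square algebra_simps)
      also have "\<dots> \<ge> l x * l y * 1" using t by simp
      finally have "l x * l y * 1 \<le> l x * l y * (k + 1)" .
      then show ?thesis using l(1)[OF x] l(1)[OF y]
        by (subst (asm) mult_le_cancel_left_pos) auto
    qed
    \<comment> \<open>Averaging the two bounds puts \<open>z\<close> above
      \<open>(k + 1) / n\<close> times \<open>p\<close>; the third summand lowers this factor to
      \<open>1 / n\<close>.\<close>
    have "(n * (1 - t) / l x) *\<^sub>R (l x *\<^sub>R x - p) + (n * t / l y) *\<^sub>R (l y *\<^sub>R y - p) + k *\<^sub>R p \<in> closure C1"
      using l[OF x] l[OF y] n t k p(1) closure_subset[of C1]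
      by (intro closure_cone_add[OF C1] closure_cone_scaleR[OF C1]) auto
    also have "(n * (1 - t) / l x) *\<^sub>R (l x *\<^sub>R x - p) + (n * t / l y) *\<^sub>R (l y *\<^sub>R y - p) + k *\<^sub>R p
      = n *\<^sub>R z - p"
    proof -
      define a b where "a = n * (1 - t) / l x" and "b = n * t / l y"
      have ab: "a * l x = n * (1 - t)" "b * l y = n * t" "k = a + b - 1"
        using l(1)[OF x] l(1)[OF y] by (auto simp: a_def b_def k_def distrib_left)
      have "a *\<^sub>R (l x *\<^sub>R x - p) + b *\<^sub>R (l y *\<^sub>R y - p) + k *\<^sub>R p
        = (a * l x) *\<^sub>R x + (b * l y) *\<^sub>R y - p"
        by (simp add: ab(3) algebra_simps)
      also have "\<dots> = n *\<^sub>R z - p" by (simp add: ab(1,2) z_def scaleR_add_right)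
      finally show ?thesis by (simp add: a_def b_def)
    qed
    finally have "n *\<^sub>R \<phi> p - \<phi> z \<in> closure C2"
      using order_reversing_iff[OF \<phi>(1) z p(1) n] by simp
    from gC[OF this] have "g \<bullet> \<phi> z \<le> n * (2 * \<delta>\<^sup>2)"
      by (simp add: inner_diff_right p(2) q(2))
    also have "\<dots> = (1 - t) * (l x * (2 * \<delta>\<^sup>2)) + t * (l y * (2 * \<delta>\<^sup>2))"
      by (simp add: n_def algebra_simps)
    finally show ?thesis using \<delta> by (simp add: l_def)
  qed
  have "((\<lambda>\<delta>. (1 - t) * (g \<bullet> \<phi> x + \<delta> * norm (\<phi> x)) + t * (g \<bullet> \<phi> y + \<delta> * norm (\<phi> y))) \<longlongrightarrow>
      (1 - t) * (g \<bullet> \<phi> x + 0 * norm (\<phi> x)) + t * (g \<bullet> \<phi> y + 0 * norm (\<phi> y))) (at_right 0)"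
    by (intro tendsto_intros)
  moreover have "\<forall>\<^sub>F \<delta> in at_right 0. g \<bullet> \<phi> z
      \<le> (1 - t) * (g \<bullet> \<phi> x + \<delta> * norm (\<phi> x)) + t * (g \<bullet> \<phi> y + \<delta> * norm (\<phi> y))"
    using bound by (auto simp: eventually_at_right_less intro: eventually_at_rightI[of 0 1])
  ultimately show "g \<bullet> \<phi> ((1 - t) *\<^sub>R x + t *\<^sub>R y) \<le> (1 - t) * (g \<bullet> \<phi> x) + t * (g \<bullet> \<phi> y)"
    unfolding z_def[symmetric] by (auto intro: tendsto_lowerbound)
qed

section \<open>Differentiability of convex functions\<close>

text \<open>A hyperplane separating the epigraph from the open vertical ray below
  \<open>(x, f x)\<close> is the graph of the supporting affine function, once it is known not to be
  vertical.\<close>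

lemma convex_on_subgradient:
  fixes f :: "'a::euclidean_space \<Rightarrow> real"
  assumes "open S" "convex_on S f" "x \<in> S"
  obtains a where "\<And>y. y \<in> S \<Longrightarrow> f x + a \<bullet> (y - x) \<le> f y"
proof -
  let ?T = "{x} \<times> {..<f x}"
  have "convex (epigraph S f)" using assms(2) by (simp add: convex_epigraph convex_on_imp_convex)
  moreover have "convex ?T" by (intro convex_Times) auto
  moreover have "epigraph S f \<noteq> {}" using assms(3) by (auto simp: epigraph_def)
  moreover have "?T \<noteq> {}" by (auto intro: lt_ex)
  moreover have "?T \<inter> epigraph S f = {}" by (auto simp: epigraph_def)
  ultimately obtain p b where p: "p \<noteq> 0" "\<forall>z\<in>?T. p \<bullet> z \<le> b" "\<forall>z\<in>epigraph S f. p \<bullet> z \<ge> b"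
    using separating_hyperplane_sets[of ?T "epigraph S f"] by blast
  obtain u c where uc: "p = (u, c)" by fastforce
  have low: "u \<bullet> x + c * r \<le> b" if "r < f x" for r
    using p(2) that uc by force
  have up: "b \<le> u \<bullet> y + c * r" if "y \<in> S" "f y \<le> r" for y r
    using p(3) that uc by (auto simp: epigraph_def)
  have c0: "c \<ge> 0" using low[of "f x - 1"] up[OF assms(3), of "f x"] by (simp add: algebra_simps)
  \<comment> \<open>A vertical hyperplane cannot separate, because \<open>S\<close> contains a point
    displaced from \<open>x\<close> against \<open>u\<close>.\<close>
  have "c \<noteq> 0"
  proof
    assume c: "c = 0"
    then have "u \<noteq> 0" using p(1) uc by (auto simp: zero_prod_def)
    obtain r where r: "r > 0" "ball x r \<subseteq> S" using assms(1,3) openE by blast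
    define t where "t = r / (2 * norm u)"
    have t: "t > 0" using r \<open>u \<noteq> 0\<close> by (simp add: t_def)
    have "x - t *\<^sub>R u \<in> S" using r \<open>u \<noteq> 0\<close> by (auto simp: subset_iff dist_norm t_def)
    from up[OF this order_refl] low[of "f x - 1"] have "t * (u \<bullet> u) \<le> 0"
      by (simp add: c inner_diff_right)
    moreover have "t * (u \<bullet> u) > 0" using t \<open>u \<noteq> 0\<close> by simp
    ultimately show False by simp
  qed
  then have c: "c > 0" using c0 by simp
  \<comment> \<open>The ray omits its top point, so the bound at \<open>f x\<close> itself is a
    limit.\<close>
  have low': "u \<bullet> x + c * f x \<le> b"
  proof (rule field_le_epsilon)
    fix e :: real assume "e > 0"
    then show "u \<bullet> x + c * f x \<le> b + e"
      using low[of "f x - e / c"] c by (simp add: right_diff_distrib)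
  qed
  show ?thesis
  proof (rule that)
    fix y assume "y \<in> S"
    then have "u \<bullet> x + c * f x \<le> u \<bullet> y + c * f y" using low' up by force
    then have "c * f x \<le> c * (f y + (u \<bullet> (y - x)) / c)"
      using c by (simp add: distrib_left inner_diff_right)
    then have "f x \<le> f y + (u \<bullet> (y - x)) / c" using c by simp
    then show "f x + (- (1 / c) *\<^sub>R u) \<bullet> (y - x) \<le> f y" by simp
  qed
qed

text \<open>Relative to a subgradient, the remainders of \<open>f\<close> at \<open>x + v\<close>
  and \<open>x - v\<close> are both nonnegative and add up to the second difference, so each is at
  most \<open>K * (norm v)\<^sup>2\<close>.\<close>

lemma convex_on_differentiable_at:
  fixes f :: "'a::euclidean_space \<Rightarrow> real"
  assumes "open S" "convex_on S f" "x \<in> S" "s > 0"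
    and le: "\<And>v. norm v < s \<Longrightarrow> f (x + v) + f (x - v) - 2 * f x \<le> K * (norm v)\<^sup>2"
  shows "f differentiable (at x)"
proof -
  obtain a where a: "\<And>y. y \<in> S \<Longrightarrow> f x + a \<bullet> (y - x) \<le> f y"
    using convex_on_subgradient[OF assms(1-3)] by blast
  obtain r where r: "r > 0" "ball x r \<subseteq> S" using assms(1,3) openE by blast
  have bound: "norm (f y - f x - a \<bullet> (y - x)) \<le> K * (norm (y - x))\<^sup>2"
    if y: "norm (y - x) < min r s" for y
  proof -
    define v where "v = y - x"
    have "x + v \<in> S" "x - v \<in> S" using r y by (auto simp: subset_iff dist_norm v_def norm_minus_commute)
    from a[OF this(1)] a[OF this(2)] have "\<bar>f (x + v) - f x - a \<bullet> v\<bar> \<le> f (x + v) + f (x - v) - 2 * f x"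
      by simp
    also have "\<dots> \<le> K * (norm v)\<^sup>2" using le[of v] y by (simp add: v_def)
    finally show ?thesis by (simp add: v_def)
  qed
  have "(f has_derivative (\<bullet>) a) (at x)"
    unfolding has_derivative_at_alt
  proof (intro conjI allI impI)
    show "bounded_linear ((\<bullet>) a)" by (rule bounded_linear_inner_right)
    fix e :: real assume e: "e > 0"
    define d where "d = min (min r s) (e / (\<bar>K\<bar> + 1))"
    have "norm (f y - f x - a \<bullet> (y - x)) \<le> e * norm (y - x)" if y: "norm (y - x) < d" for y
    proof -
      have "(\<bar>K\<bar> + 1) * norm (y - x) \<le> e" using y by (simp add: d_def field_simps)
      moreover have "K * norm (y - x) \<le> (\<bar>K\<bar> + 1) * norm (y - x)" by (intro mult_right_mono) auto
      ultimately have "K * norm (y - x) * norm (y - x) \<le> e * norm (y - x)"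
        by (intro mult_right_mono) auto
      then show ?thesis using bound[of y] y by (simp add: d_def power2_eq_square mult.assoc)
    qed
    moreover have "d > 0" using e r assms(4) by (simp add: d_def)
    ultimately show "\<exists>d>0. \<forall>y. norm (y - x) < d \<longrightarrow>
        norm (f y - f x - a \<bullet> (y - x)) \<le> e * norm (y - x)" by blast
  qed
  then show ?thesis by (auto simp: differentiable_def)
qed

text \<open>At an interior maximum \<open>x1\<close> of \<open>H\<close>, a paraboloid touches
  \<open>f\<close> from above, so its second difference bounds that of \<open>f\<close>. Convexity
  supplies the continuity that makes the maximum exist.\<close>

lemma convex_on_second_difference_bounded:
  fixes f :: "'a::euclidean_space \<Rightarrow> real"
  assumes "open S" "convex_on S f" "S \<noteq> {}"
  obtains x s K where "x \<in> S" "s > 0"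
    "\<And>v. norm v < s \<Longrightarrow> f (x + v) + f (x - v) - 2 * f x \<le> K * (norm v)\<^sup>2"
proof -
  obtain x0 where "x0 \<in> S" using assms(3) by blast
  then obtain r where r: "r > 0" "cball x0 r \<subseteq> S"
    using assms(1) open_contains_cball by blast
  have cont: "continuous_on (cball x0 r) f"
    using convex_on_continuous[OF assms(1,2)] r(2) continuous_on_subset by blast
  obtain m where m: "\<And>x. x \<in> cball x0 r \<Longrightarrow> f x \<le> f m"
    using continuous_attains_sup[OF compact_cball _ cont] r(1) by fastforce
  define K where "K = (\<bar>f m - f x0\<bar> + 1) / r\<^sup>2"
  \<comment> \<open>\<open>K\<close> is so large that the maximum of \<open>H\<close> over the ball is not attained on its boundary.\<close>
  define H where "H x = f x - K * (norm (x - x0))\<^sup>2" for x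
  have "continuous_on (cball x0 r) H"
    unfolding H_def by (intro continuous_intros cont)
  then obtain x1 where x1: "x1 \<in> cball x0 r" "\<And>x. x \<in> cball x0 r \<Longrightarrow> H x \<le> H x1"
    using continuous_attains_sup[OF compact_cball, of x0 r H] r(1) by fastforce
  have "norm (x1 - x0) \<noteq> r"
  proof
    assume "norm (x1 - x0) = r"
    then have "H x1 = f x1 - (\<bar>f m - f x0\<bar> + 1)" using r(1) by (simp add: H_def K_def)
    moreover have "H x0 \<le> H x1" using x1(2) r(1) by simp
    then have "f x0 \<le> H x1" by (simp add: H_def)
    ultimately show False using m[OF x1(1)] by linarith
  qed
  then have "x1 \<in> ball x0 r" using x1(1) by (auto simp: dist_norm norm_minus_commute)
  then obtain s where s: "s > 0" "ball x1 s \<subseteq> ball x0 r"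
    using open_ball openE by blast
  show ?thesis
  proof (rule that[of x1 s "2 * K"])
    show "x1 \<in> S" using x1(1) r(2) by blast
    show "s > 0" by fact
    fix v :: 'a assume "norm v < s"
    then have "x1 + v \<in> ball x0 r" "x1 - v \<in> ball x0 r"
      using s(2) by (auto simp: subset_iff dist_norm)
    then have "H (x1 + v) + H (x1 - v) \<le> 2 * H x1"
      using x1(2)[of "x1 + v"] x1(2)[of "x1 - v"] by auto
    \<comment> \<open>The parallelogram law for \<open>x1 - x0\<close> and \<open>v\<close>.\<close>
    moreover have "(norm (x1 + v - x0))\<^sup>2 + (norm (x1 - v - x0))\<^sup>2 - 2 * (norm (x1 - x0))\<^sup>2 = 2 * (norm v)\<^sup>2"
      unfolding power2_norm_eq_inner
      by (simp add: inner_diff_left inner_diff_right inner_add_left inner_add_right inner_commute)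
    then have "K * (norm (x1 + v - x0))\<^sup>2 + K * (norm (x1 - v - x0))\<^sup>2 - 2 * (K * (norm (x1 - x0))\<^sup>2)
        = 2 * K * (norm v)\<^sup>2"
      by (metis (no_types) distrib_left right_diff_distrib mult.assoc mult.left_commute)
    ultimately show "f (x1 + v) + f (x1 - v) - 2 * f x1 \<le> 2 * K * (norm v)\<^sup>2"
      by (simp add: H_def)
  qed
qed

text \<open>Second differences of convex functions are nonnegative, so a bound for that of the sum
  at one point bounds every summand there.\<close>

lemma convex_on_common_differentiable:
  fixes f :: "'i \<Rightarrow> 'a::euclidean_space \<Rightarrow> real"
  assumes "open S" "S \<noteq> {}" "finite I" and conv: "\<And>i. i \<in> I \<Longrightarrow> convex_on S (f i)"
  obtains x where "x \<in> S" "\<And>i. i \<in> I \<Longrightarrow> f i differentiable (at x)"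
proof (cases "I = {}")
  \<comment> \<open>Convexity of \<open>S\<close> is available only through a member of the family,
    so the empty sum is not known to be convex on \<open>S\<close>.\<close>
  case True
  then show ?thesis using that assms(2) by blast
next
  case False
  define F where "F x = (\<Sum>i\<in>I. f i x)" for x
  have "convex_on S F"
    unfolding F_def using assms(3) False conv
  proof (induction rule: finite_ne_induct)
    case (insert i I)
    then show ?case by (simp add: convex_on_add)
  qed simp
  then obtain x s K where x: "x \<in> S" "s > 0"
    "\<And>v. norm v < s \<Longrightarrow> F (x + v) + F (x - v) - 2 * F x \<le> K * (norm v)\<^sup>2"
    using convex_on_second_difference_bounded[OF assms(1) _ assms(2)] by metis
  obtain r where r: "r > 0" "ball x r \<subseteq> S" using assms(1) x(1) openE by blast
  show ?thesis
  proof (rule that[OF x(1)])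
    fix i assume i: "i \<in> I"
    have "f i (x + v) + f i (x - v) - 2 * f i x \<le> K * (norm v)\<^sup>2" if v: "norm v < min r s" for v
    proof -
      have mem: "x + v \<in> S" "x - v \<in> S" using r v by (auto simp: subset_iff dist_norm)
      have nonneg: "0 \<le> f j (x + v) + f j (x - v) - 2 * f j x" if "j \<in> I" for j
      proof -
        have "(1/2) *\<^sub>R (x + v) + (1/2) *\<^sub>R (x - v) = x"
          by (simp add: algebra_simps flip: scaleR_add_left)
        then show ?thesis
          using convex_onD[OF conv[OF that], of "1/2" "x + v" "x - v"] mem by simp
      qed
      have "f i (x + v) + f i (x - v) - 2 * f i x \<le> (\<Sum>j\<in>I. f j (x + v) + f j (x - v) - 2 * f j x)"
        using nonneg i assms(3) by (intro member_le_sum) auto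
      also have "\<dots> = F (x + v) + F (x - v) - 2 * F x"
        by (simp add: F_def sum.distrib sum_subtractf sum_distrib_left)
      also have "\<dots> \<le> K * (norm v)\<^sup>2" using x(3) v by simp
      finally show ?thesis .
    qed
    then show "f i differentiable (at x)"
      using convex_on_differentiable_at[OF assms(1) conv[OF i] x(1), of "min r s"] r(1) x(2) by auto
  qed
qed

section \<open>The derivative of an order-reversing map\<close>

text \<open>A basis chosen among the exposed functionals reduces the question to finitely many
  convex functions; linear combinations then reach every coordinate of
  \<open>\<phi>\<close>.\<close>

lemma order_reversing_differentiable:
  fixes C1 :: "'a::euclidean_space set" and C2 :: "'b::euclidean_space set"
  assumes C1: "proper_open_convex_cone C1" and C2: "proper_open_convex_cone C2"
    and \<phi>: "order_reversing C1 C2 \<phi>" "bij_betw \<phi> C1 C2"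
  obtains x where "x \<in> C1" "\<phi> differentiable (at x)"
proof -
  obtain e where e: "e \<in> C2" using proper_open_convex_coneD(1)[OF C2] by blast
  obtain B where B: "B \<subseteq> farthest_dual C2 e" "independent B" "farthest_dual C2 e \<subseteq> span B"
    using maximal_independent_subset by blast
  have spanB: "span B = UNIV"
    using span_minimal[OF B(3) subspace_span] span_farthest_dual[OF C2 e] by auto
  obtain x where x: "x \<in> C1" "\<And>g. g \<in> B \<Longrightarrow> (\<lambda>x. g \<bullet> \<phi> x) differentiable (at x)"
    using convex_on_common_differentiable[OF proper_open_convex_coneD(2,1)[OF C1]
        finiteI_independent[OF B(2)], of "\<lambda>g x. g \<bullet> \<phi> x"]
      convex_on_exposed_comp[OF C1 C2 \<phi> e] B(1) by blast
  have "(\<lambda>x. g \<bullet> \<phi> x) differentiable (at x)" for g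
  proof -
    have "g \<in> span B" using spanB by simp
    then show ?thesis
      by (induction rule: span_induct_alt)
        (auto simp: inner_add_left intro!: differentiable_add differentiable_mult x(2))
  qed
  then have "\<phi> differentiable (at x)"
    using differentiable_componentwise_within[of \<phi> x UNIV] by (simp add: inner_commute)
  with x(1) show ?thesis by (rule that)
qed

text \<open>For small positive \<open>t\<close>, the quotients converging to \<open>A u\<close> lie
  in the closed cone exactly when \<open>u\<close> does. One implication survives the limit by
  closedness; the other is first proved for \<open>A u\<close> in the open cone and then extended by
  perturbing \<open>u\<close>.\<close>

lemma order_reversing_imp_order_embedding:
  fixes C1 :: "'a::euclidean_space set" and C2 :: "'b::euclidean_space set"
  assumes C1: "proper_open_convex_cone C1" and C2: "proper_open_convex_cone C2"
    and \<phi>: "order_reversing C1 C2 \<phi>" "bij_betw \<phi> C1 C2"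
  obtains A where "linear A" "\<And>u. A u \<in> closure C2 \<longleftrightarrow> u \<in> closure C1"
proof -
  note C1' = proper_open_convex_coneD[OF C1] and C2' = proper_open_convex_coneD[OF C2]
  obtain x L where x: "x \<in> C1" and L: "(\<phi> has_derivative L) (at x)"
    using order_reversing_differentiable[OF assms] unfolding differentiable_def by metis
  have linL: "linear L" using L by (rule has_derivative_linear)
  define A where "A u = - L u" for u
  have linA: "linear A" unfolding A_def using linL by (rule linear_compose_neg)
  have \<phi>x: "\<phi> x \<in> C2" by (rule order_reversing_mem[OF \<phi>(1) x])
  have quot: "((\<lambda>t. (1/t) *\<^sub>R (\<phi> x - \<phi> (x + t *\<^sub>R u))) \<longlongrightarrow> A u) (at_right 0)" for u
  proof -
    have "((\<lambda>t. x + t *\<^sub>R u) has_derivative (\<lambda>t. t *\<^sub>R u)) (at_right 0)"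
      by (auto intro!: derivative_eq_intros)
    moreover have "(\<phi> has_derivative L) (at (x + 0 *\<^sub>R u))" using L by simp
    ultimately have "((\<lambda>t. \<phi> (x + t *\<^sub>R u)) has_derivative (\<lambda>t. L (t *\<^sub>R u))) (at_right 0)"
      by (rule has_derivative_compose)
    then have "((\<lambda>t. (1 / norm (t - 0)) *\<^sub>R (\<phi> (x + t *\<^sub>R u) - (\<phi> (x + 0 *\<^sub>R u) + L ((t - 0) *\<^sub>R u)))) \<longlongrightarrow> 0)
        (at_right 0)"
      unfolding has_derivative_within by blast
    moreover have "\<forall>\<^sub>F t in at_right 0.
        (1 / norm (t - 0)) *\<^sub>R (\<phi> (x + t *\<^sub>R u) - (\<phi> (x + 0 *\<^sub>R u) + L ((t - 0) *\<^sub>R u)))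
          = (1/t) *\<^sub>R (\<phi> (x + t *\<^sub>R u) - \<phi> x) - L u"
      using eventually_at_right_less[of "0::real"]
      by eventually_elim (simp add: linear_scale[OF linL] scaleR_diff_right scaleR_add_right)
    ultimately have "((\<lambda>t. (1/t) *\<^sub>R (\<phi> (x + t *\<^sub>R u) - \<phi> x) - L u) \<longlongrightarrow> 0) (at_right 0)"
      by (rule Lim_transform_eventually)
    then have "((\<lambda>t. (1/t) *\<^sub>R (\<phi> (x + t *\<^sub>R u) - \<phi> x)) \<longlongrightarrow> L u) (at_right 0)"
      by (rule LIM_zero_cancel)
    from tendsto_minus[OF this] show ?thesis
      by (simp add: A_def flip: scaleR_minus_right)
  qed
  have inC1: "\<forall>\<^sub>F t in at_right 0. x + t *\<^sub>R u \<in> C1" for u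
  proof -
    have "((\<lambda>t. x + t *\<^sub>R u) \<longlongrightarrow> x + 0 *\<^sub>R u) (at_right 0)" by (intro tendsto_intros)
    then show ?thesis using topological_tendstoD[OF _ C1'(2)] x by fastforce
  qed
  have pos: "\<forall>\<^sub>F t in at_right (0::real). t > 0" by (rule eventually_at_right_less)
  have quot_mem: "(1/t) *\<^sub>R (\<phi> x - \<phi> (x + t *\<^sub>R u)) \<in> closure C2 \<longleftrightarrow> u \<in> closure C1"
    if t: "t > 0" "x + t *\<^sub>R u \<in> C1" for t u
  proof -
    have "(1/t) *\<^sub>R (\<phi> x - \<phi> (x + t *\<^sub>R u)) \<in> closure C2 \<longleftrightarrow> \<phi> x - \<phi> (x + t *\<^sub>R u) \<in> closure C2"
      using closure_cone_scaleR[OF C2, of "(1/t) *\<^sub>R (\<phi> x - \<phi> (x + t *\<^sub>R u))" t]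
        closure_cone_scaleR[OF C2, of "\<phi> x - \<phi> (x + t *\<^sub>R u)" "1/t"] t by auto
    also have "\<dots> \<longleftrightarrow> t *\<^sub>R u \<in> closure C1"
      using order_reversing_iff[OF \<phi>(1) t(2) x, of 1] by simp
    also have "\<dots> \<longleftrightarrow> u \<in> closure C1"
      using closure_cone_scaleR[OF C1, of "t *\<^sub>R u" "1/t"] closure_cone_scaleR[OF C1, of u t] t by auto
    finally show ?thesis .
  qed
  have fwd: "A u \<in> closure C2" if "u \<in> closure C1" for u
  proof -
    have "\<forall>\<^sub>F t in at_right 0. (1/t) *\<^sub>R (\<phi> x - \<phi> (x + t *\<^sub>R u)) \<in> closure C2"
      using inC1[of u] pos by eventually_elim (use quot_mem that in blast)
    then show ?thesis
      by (rule Lim_in_closed_set[OF closed_closure _ _ quot]) simp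
  qed
  \<comment> \<open>A limit in the open set \<open>C2\<close> forces the quotients into
    \<open>C2\<close> eventually; a limit in its closure would not.\<close>
  have bwd: "u \<in> closure C1" if "A u \<in> C2" for u
  proof -
    have "\<forall>\<^sub>F t in at_right 0. (1/t) *\<^sub>R (\<phi> x - \<phi> (x + t *\<^sub>R u)) \<in> C2"
      by (rule topological_tendstoD[OF quot C2'(2) that])
    then have "\<forall>\<^sub>F t in at_right (0::real). u \<in> closure C1"
      using inC1[of u] pos by eventually_elim (use quot_mem closure_subset[of C2] in blast)
    then show ?thesis by simp
  qed
  \<comment> \<open>Euler's relation for homogeneity of degree -1. It provides a vector of
    \<open>C1\<close> that \<open>A\<close> sends into the open cone.\<close>
  have Ax: "A x = \<phi> x"
  proof -
    have "\<forall>\<^sub>F t in at_right 0. (1/t) *\<^sub>R (\<phi> x - \<phi> (x + t *\<^sub>R x)) = (1 / (1 + t)) *\<^sub>R \<phi> x"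
      using pos
    proof eventually_elim
      case (elim t)
      have "\<phi> (x + t *\<^sub>R x) = (1 / (1 + t)) *\<^sub>R \<phi> x"
        using order_reversing_scaleR[OF C1 C2 \<phi>(1) x, of "1 + t"] elim by (simp add: scaleR_add_left)
      then have "(1/t) *\<^sub>R (\<phi> x - \<phi> (x + t *\<^sub>R x)) = ((1/t) * (1 - 1 / (1 + t))) *\<^sub>R \<phi> x"
        by (simp add: algebra_simps)
      also have "(1/t) * (1 - 1 / (1 + t)) = 1 / (1 + t)" using elim by (simp add: field_simps)
      finally show ?case .
    qed
    moreover have "((\<lambda>t. (1 / (1 + t)) *\<^sub>R \<phi> x) \<longlongrightarrow> (1 / (1 + 0)) *\<^sub>R \<phi> x) (at_right 0)"
      by (intro tendsto_intros) auto
    ultimately have "((\<lambda>t. (1/t) *\<^sub>R (\<phi> x - \<phi> (x + t *\<^sub>R x))) \<longlongrightarrow> \<phi> x) (at_right 0)"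
      by (simp add: tendsto_cong)
    then show ?thesis using tendsto_unique[OF _ quot] by force
  qed
  have "u \<in> closure C1" if "A u \<in> closure C2" for u
  proof -
    \<comment> \<open>Small positive multiples of \<open>x\<close> push \<open>A u\<close> into
      \<open>C2\<close>, where \<open>bwd\<close> applies; closedness removes them again.\<close>
    have "u + inverse (real (Suc n)) *\<^sub>R x \<in> closure C1" for n
    proof (rule bwd)
      have "inverse (real (Suc n)) *\<^sub>R \<phi> x \<in> C2" using C2'(4) \<phi>x by simp
      then show "A (u + inverse (real (Suc n)) *\<^sub>R x) \<in> C2"
        using closure_cone_add_interior[OF C2 that]
        by (simp add: linear_add[OF linA] linear_scale[OF linA] Ax)
    qed
    moreover have "(\<lambda>n. u + inverse (real (Suc n)) *\<^sub>R x) \<longlonglongrightarrow> u + 0 *\<^sub>R x"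
      by (intro tendsto_intros LIMSEQ_inverse_real_of_nat)
    ultimately show ?thesis using closed_sequentially[OF closed_closure] by fastforce
  qed
  with fwd linA show ?thesis by (intro that) blast+
qed

lemma order_embedding_inj:
  assumes C1: "proper_open_convex_cone C1" and C2: "proper_open_convex_cone C2"
    and A: "linear A" "\<And>u. A u \<in> closure C2 \<longleftrightarrow> u \<in> closure C1"
  shows "inj A"
  unfolding linear_injective_0[OF A(1)]
proof (intro allI impI)
  fix u assume "A u = 0"
  then have "A u \<in> closure C2" "A (- u) \<in> closure C2"
    using proper_open_convex_coneD(6)[OF C2] by (auto simp: linear_neg[OF A(1)])
  then show "u = 0" using proper_open_convex_coneD(5)[OF C1] A(2) by blast
qed

text \<open>The embeddings obtained from \<open>\<phi>\<close> and from its inverse force equal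
  dimensions, so the injective \<open>A\<close> is onto; \<open>B\<close> serves only this
  comparison. An open convex set is the interior of its closure, which brings the closed cones back
  to the open ones.\<close>

lemma order_reversing_imp_isomorphic:
  fixes C1 :: "'a::euclidean_space set" and C2 :: "'b::euclidean_space set"
  assumes C1: "proper_open_convex_cone C1" and C2: "proper_open_convex_cone C2"
    and \<phi>: "order_reversing C1 C2 \<phi>" "bij_betw \<phi> C1 C2"
  obtains A where "linear A" "bij A" "A ` C1 = C2"
proof -
  obtain A where A: "linear A" "\<And>u. A u \<in> closure C2 \<longleftrightarrow> u \<in> closure C1"
    using order_reversing_imp_order_embedding[OF assms] by blast
  obtain B where B: "linear B" "\<And>u. B u \<in> closure C1 \<longleftrightarrow> u \<in> closure C2"
    using order_reversing_imp_order_embedding[OF C2 C1 order_reversing_inv_into[OF \<phi>]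
        bij_betw_inv_into[OF \<phi>(2)]] by blast
  have injA: "inj A" by (rule order_embedding_inj[OF C1 C2 A])
  have injB: "inj B" by (rule order_embedding_inj[OF C2 C1 B])
  have "DIM('a) = DIM('b)"
    using dim_image_eq[OF A(1), of UNIV] dim_image_eq[OF B(1), of UNIV] injA injB
      dim_subset_UNIV[of "range A"] dim_subset_UNIV[of "range B"] by (simp add: dim_UNIV)
  then have "surj A"
    using dim_image_eq[OF A(1), of UNIV] injA dim_eq_full[of "range A"] A(1)
    by (simp add: span_linear_image dim_UNIV)
  have "A ` closure C1 = closure C2"
  proof -
    have "closure C1 = A -` closure C2" using A(2) by auto
    then show ?thesis using \<open>surj A\<close> by (simp add: surj_image_vimage_eq)
  qed
  then have "interior (A ` closure C1) = interior (closure C2)" by simp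
  then have "A ` C1 = C2"
    using proper_open_convex_coneD(2,3)[OF C1] proper_open_convex_coneD(2,3)[OF C2]
    by (simp add: interior_bijective_linear_image[OF A(1)] bijI injA \<open>surj A\<close> convex_interior_closure interior_open)
  then show ?thesis using A(1) injA \<open>surj A\<close> by (intro that) (auto simp: bij_def)
qed

section \<open>From normed to Euclidean spaces\<close>

text \<open>
  An index type with \<open>dim (UNIV :: 'a set)\<close> elements, truncated to at least one because types are
  nonempty. It makes \<open>real ^ 'a dim_index\<close> a Euclidean space isomorphic to \<open>'a\<close> whenever \<open>'a\<close> has
  finite positive dimension.
\<close>

typedef (overloaded) ('a::real_vector) dim_index = "{i. i < max 1 (dim (UNIV :: 'a set))}"
  by (rule exI[of _ 0]) simp

instance dim_index :: (real_vector) finite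
proof
  have "finite (Abs_dim_index ` {i. i < max 1 (dim (UNIV :: 'a set))} :: 'a dim_index set)"
    by (intro finite_imageI finite_Collect_less_nat)
  then show "finite (UNIV :: 'a dim_index set)"
    by (subst (asm) type_definition.Abs_image[OF type_definition_dim_index])
qed

lemma CARD_dim_index: "CARD('a::real_vector dim_index) = max 1 (dim (UNIV :: 'a set))"
  using type_definition.card[OF type_definition_dim_index] by simp

text \<open>\<open>S\<close> is bounded because its domain is Euclidean. For \<open>T\<close>, the
  function \<open>norm (S y)\<close> has a positive minimum on the compact unit sphere. The vector
  \<open>z\<close> makes the dimension positive, so the truncation in the index type has no
  effect.\<close>

lemma finite_span_linear_homeomorphism:
  fixes B :: "'a::real_normed_vector set"
  assumes "finite B" "span B = UNIV" "z \<noteq> (0::'a)"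
  obtains T :: "'a \<Rightarrow> real ^ 'a dim_index" and S
  where "bounded_linear T" "bounded_linear S" "\<And>x. S (T x) = x" "\<And>y. T (S y) = y"
proof -
  obtain B' :: "'a set" where B': "B' \<subseteq> B" "independent B'" "B \<subseteq> span B'"
    using maximal_independent_subset by blast
  have span: "span B' = UNIV"
    using span_minimal[OF B'(3) subspace_span] assms(2) by auto
  have fin: "finite B'" using B'(1) assms(1) finite_subset by blast
  have "B' \<noteq> {}" using span assms(3) by auto
  then have "card B' \<noteq> 0" using fin by simp
  then have card: "card B' = DIM(real ^ 'a dim_index)"
    using dim_span_eq_card_independent[OF B'(2)] by (simp add: span CARD_dim_index)
  have "\<exists>S :: real ^ 'a dim_index \<Rightarrow> 'a. linear S \<and> S ` Basis = B' \<and> S ` UNIV = UNIV \<and> inj_on S UNIV"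
  proof (rule finite_basis_to_basis_subspace_isomorphism)
    show "dim (UNIV :: (real ^ 'a dim_index) set) = dim (UNIV :: 'a set)"
      using card dim_span_eq_card_independent[OF B'(2)] by (simp add: span)
    show "card B' = dim (UNIV :: 'a set)"
      using dim_span_eq_card_independent[OF B'(2)] by (simp add: span)
  qed (use fin B'(2) span in \<open>auto simp: independent_Basis\<close>)
  then obtain S :: "real ^ 'a dim_index \<Rightarrow> 'a" where S: "linear S" "inj S" "surj S"
    by blast
  define T where "T = inv S"
  have ST: "S (T x) = x" for x unfolding T_def using S(3) by (rule surj_f_inv_f)
  have TS: "T (S y) = y" for y unfolding T_def using S(2) by (rule inv_f_f)
  have linT: "linear T"
  proof (rule linearI)
    show "T (x + y) = T x + T y" for x y
      using TS[of "T x + T y"] by (simp add: linear_add[OF S(1)] ST)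
    show "T (c *\<^sub>R x) = c *\<^sub>R T x" for c x
      using TS[of "c *\<^sub>R T x"] by (simp add: linear_scale[OF S(1)] ST)
  qed
  have bS: "bounded_linear S" using S(1) by (simp add: linear_conv_bounded_linear)
  have "continuous_on (sphere 0 1) (\<lambda>y. norm (S y))"
    using bS by (intro continuous_intros linear_continuous_on)
  moreover have "sphere (0 :: real ^ 'a dim_index) 1 \<noteq> {}"
    using sphere_eq_empty[of "0 :: real ^ 'a dim_index" 1] by simp
  ultimately obtain y0 where y0: "y0 \<in> sphere 0 1" "\<And>y. y \<in> sphere 0 1 \<Longrightarrow> norm (S y0) \<le> norm (S y)"
    using continuous_attains_inf[OF compact_sphere, of "0 :: real ^ 'a dim_index" 1] by metis
  define m where "m = norm (S y0)"
  have "S y0 \<noteq> 0"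
  proof
    assume "S y0 = 0"
    then have "y0 = 0" using TS[of y0] linear_0[OF linT] by simp
    then show False using y0(1) by simp
  qed
  then have m: "m > 0" by (simp add: m_def)
  have "bounded_linear T"
  proof (rule bounded_linear_intro)
    show "T (x + y) = T x + T y" "T (c *\<^sub>R x) = c *\<^sub>R T x" for x y c
      by (simp_all add: linear_add[OF linT] linear_scale[OF linT])
    show "norm (T x) \<le> norm x * (1 / m)" for x
    proof (cases "T x = 0")
      case False
      then have "m \<le> norm (S ((1 / norm (T x)) *\<^sub>R T x))"
        unfolding m_def by (intro y0(2)) simp
      also have "\<dots> = norm x / norm (T x)" by (simp add: linear_scale[OF S(1)] ST)
      finally show ?thesis using m False by (simp add: field_simps)
    qed (use m in simp)
  qed
  then show ?thesis using bS ST TS by (rule that)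
qed

lemma closure_linear_homeomorphism:
  assumes "bounded_linear T" "bounded_linear S" "\<And>x. S (T x) = x" "\<And>y. T (S y) = y"
  shows "y \<in> closure (T ` C) \<longleftrightarrow> S y \<in> closure C"
proof
  assume "y \<in> closure (T ` C)"
  then have "S y \<in> closure (S ` T ` C)"
    using closure_bounded_linear_image_subset[OF assms(2), of "T ` C"] by blast
  then show "S y \<in> closure C" by (simp add: image_image assms(3))
next
  assume "S y \<in> closure C"
  then have "T (S y) \<in> closure (T ` C)"
    using closure_bounded_linear_image_subset[OF assms(1), of C] by blast
  then show "y \<in> closure (T ` C)" by (simp add: assms(4))
qed

lemma proper_open_convex_cone_linear_homeomorphism:
  assumes T: "bounded_linear T" "bounded_linear S" "\<And>x. S (T x) = x" "\<And>y. T (S y) = y"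
    and C: "proper_open_convex_cone C"
  shows "proper_open_convex_cone (T ` C)"
proof -
  note C' = proper_open_convex_coneD[OF C]
  have lin: "linear T" "linear S" using T by (auto intro: bounded_linear.linear)
  have "T ` C = S -` C"
  proof (intro equalityI subsetI)
    show "y \<in> T ` C" if "y \<in> S -` C" for y
      using that T(4)[of y] by (intro image_eqI[of _ _ "S y"]) auto
  qed (auto simp: T(3))
  then have "open (T ` C)"
    using open_vimage[OF C'(2) linear_continuous_on[OF T(2)]] by simp
  moreover have "\<forall>x\<in>T ` C. \<forall>t>0. t *\<^sub>R x \<in> T ` C"
    using C'(4) by (auto simp flip: linear_scale[OF lin(1)])
  moreover have "closure (T ` C) \<inter> uminus ` closure (T ` C) = {0}"
  proof (intro equalityI subsetI)
    fix y assume "y \<in> closure (T ` C) \<inter> uminus ` closure (T ` C)"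
    then have "S y \<in> closure C" "- S y \<in> closure C"
      by (auto simp: closure_linear_homeomorphism[OF T] linear_neg[OF lin(2)])
    then have "S y = 0" by (rule C'(5))
    then show "y \<in> {0}" using T(4)[of y] linear_0[OF lin(1)] by simp
  next
    have "0 \<in> closure (T ` C)"
      using C'(6) by (simp add: closure_linear_homeomorphism[OF T] linear_0[OF lin(2)])
    moreover from this have "0 \<in> uminus ` closure (T ` C)" by (rule rev_image_eqI) simp
    ultimately show "y \<in> closure (T ` C) \<inter> uminus ` closure (T ` C)" if "y \<in> {0}" for y
      using that by simp
  qed
  ultimately show ?thesis
    using C'(1) convex_linear_image[OF lin(1) C'(3)] by (simp add: proper_open_convex_cone_def)
qed

text \<open>Recognises the zero space by the size of its cone, a property that a mere bijection
  between cones transfers.\<close>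

lemma singleton_cone:
  fixes c :: "'a::real_normed_vector"
  assumes "proper_open_convex_cone {c}"
  shows "z = (0::'a)"
proof -
  have "2 *\<^sub>R c \<in> {c}" by (rule proper_open_convex_coneD(4)[OF assms]) auto
  then have "c = 0" by (simp add: scaleR_2)
  then show ?thesis using zero_notin_cone[OF assms] by blast
qed

theorem corollary1p2:
  fixes C1 :: "'a::real_normed_vector set" and C2 :: "'b::real_normed_vector set"
  assumes "\<exists>B::'a set. finite B \<and> span B = UNIV"
    and "\<exists>B::'b set. finite B \<and> span B = UNIV"
    and "proper_open_convex_cone C1"
    and "proper_open_convex_cone C2"
    and "\<exists>\<phi>. gauge_reversing C1 C2 \<phi> \<and> bij_betw \<phi> C1 C2"
  shows "\<exists>A::'a \<Rightarrow> 'b. linear A \<and> bij A \<and> A ` C1 = C2"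
proof -
  obtain \<phi> where \<phi>: "gauge_reversing C1 C2 \<phi>" "bij_betw \<phi> C1 C2" using assms(5) by blast
  note rev = gauge_reversing_imp_order_reversing[OF assms(3,4) \<phi>(1)]
  note ne = proper_open_convex_coneD(1)[OF assms(3)] proper_open_convex_coneD(1)[OF assms(4)]
  show ?thesis
  proof (cases "(\<forall>z::'a. z = 0) \<or> (\<forall>z::'b. z = 0)")
    case True
    \<comment> \<open>If one space is zero, its cone is a single point, hence so is the other cone,
      and the other space is zero too.\<close>
    have "\<exists>c. C1 = {c}" "\<exists>c. C2 = {c}"
    proof -
      have "card C1 = 1 \<or> card C2 = 1"
        using True
      proof
        assume "\<forall>z::'a. z = 0"
        then have "C1 = {0}" using ne(1) subset_singletonD[of C1 0] by blast
        then show ?thesis by simp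
      next
        assume "\<forall>z::'b. z = 0"
        then have "C2 = {0}" using ne(2) subset_singletonD[of C2 0] by blast
        then show ?thesis by simp
      qed
      then have "card C1 = 1" "card C2 = 1" using bij_betw_same_card[OF \<phi>(2)] by auto
      then show "\<exists>c. C1 = {c}" "\<exists>c. C2 = {c}" by (auto simp: card_1_singleton_iff)
    qed
    then have zero: "\<forall>z::'a. z = 0" "\<forall>w::'b. w = 0"
      using singleton_cone assms(3,4) by blast+
    have "C1 \<subseteq> {0}" "C2 \<subseteq> {0}" using zero by blast+
    then have "C1 = {0}" "C2 = {0}" using ne by (blast dest: subset_singletonD)+
    moreover have "bij (\<lambda>_::'a. 0::'b)"
    proof (rule bijI)
      show "inj (\<lambda>_::'a. 0::'b)"
      proof (rule injI)
        fix x y :: 'a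
        have "x = 0" "y = 0" using zero(1) by blast+
        then show "x = y" by simp
      qed
      show "surj (\<lambda>_::'a. 0::'b)"
      proof (rule surjI)
        fix y :: 'b
        show "0 = y" using zero(2) by (rule allE) (rule sym)
      qed
    qed
    moreover have "linear (\<lambda>_::'a. 0::'b)" by (rule linear_zero)
    ultimately show ?thesis by (intro exI[of _ "\<lambda>_. 0"]) simp
  next
    case False
    then obtain z :: 'a and w :: 'b where "z \<noteq> 0" "w \<noteq> 0" by blast
    obtain T1 :: "'a \<Rightarrow> real ^ 'a dim_index" and S1 where
      1: "bounded_linear T1" "bounded_linear S1" "\<And>x. S1 (T1 x) = x" "\<And>y. T1 (S1 y) = y"
      using finite_span_linear_homeomorphism[OF _ _ \<open>z \<noteq> 0\<close>] assms(1) by metis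
    obtain T2 :: "'b \<Rightarrow> real ^ 'b dim_index" and S2 where
      2: "bounded_linear T2" "bounded_linear S2" "\<And>x. S2 (T2 x) = x" "\<And>y. T2 (S2 y) = y"
      using finite_span_linear_homeomorphism[OF _ _ \<open>w \<noteq> 0\<close>] assms(2) by metis
    note lin = bounded_linear.linear[OF 1(1)] bounded_linear.linear[OF 2(2)]
      bounded_linear.linear[OF 1(2)]
    \<comment> \<open>\<open>\<phi>\<close> in Euclidean coordinates. Since
      \<open>order_reversing\<close> speaks only of linear operations and closed cones, it survives
      this change of coordinates.\<close>
    define \<psi> where "\<psi> = T2 \<circ> \<phi> \<circ> S1"
    have inj: "inj_on T2 C2" "inj_on S1 (T1 ` C1)"
      using 1(4) 2(3) by (metis inj_on_def)+
    have bij: "bij_betw \<psi> (T1 ` C1) (T2 ` C2)"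
      unfolding \<psi>_def using inj \<phi>(2) 1(3)
      by (intro bij_betw_trans[of S1 _ C1] bij_betw_trans[of \<phi> C1 C2])
        (auto simp: bij_betw_def image_image)
    have "order_reversing (T1 ` C1) (T2 ` C2) \<psi>"
      unfolding order_reversing_def
    proof (intro conjI ballI allI impI)
      show "\<psi> \<in> T1 ` C1 \<rightarrow> T2 ` C2" using bij by (auto simp: bij_betw_def)
      fix x y and l :: real assume xy: "x \<in> T1 ` C1" "y \<in> T1 ` C1" and "l > 0"
      then have mem: "S1 x \<in> C1" "S1 y \<in> C1" using 1(3) by auto
      have "l *\<^sub>R \<psi> y - \<psi> x \<in> closure (T2 ` C2) \<longleftrightarrow> l *\<^sub>R \<phi> (S1 y) - \<phi> (S1 x) \<in> closure C2"
        by (simp add: closure_linear_homeomorphism[OF 2] \<psi>_def linear_diff[OF lin(2)]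
            linear_scale[OF lin(2)] 2(3))
      also have "\<dots> \<longleftrightarrow> l *\<^sub>R S1 x - S1 y \<in> closure C1"
        by (rule order_reversing_iff[OF rev mem \<open>l > 0\<close>])
      also have "\<dots> \<longleftrightarrow> l *\<^sub>R x - y \<in> closure (T1 ` C1)"
        by (simp add: closure_linear_homeomorphism[OF 1] linear_diff[OF lin(3)] linear_scale[OF lin(3)])
      finally show "l *\<^sub>R \<psi> y - \<psi> x \<in> closure (T2 ` C2) \<longleftrightarrow> l *\<^sub>R x - y \<in> closure (T1 ` C1)" .
    qed
    then obtain A where A: "linear A" "bij A" "A ` T1 ` C1 = T2 ` C2"
      using order_reversing_imp_isomorphic
        [OF proper_open_convex_cone_linear_homeomorphism[OF 1 assms(3)]
          proper_open_convex_cone_linear_homeomorphism[OF 2 assms(4)] _ bij] by blast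
    have "bij T1" "bij S2" using 1(3,4) 2(3,4) by (metis bijI' )+
    then have "bij (S2 \<circ> A \<circ> T1)" using A(2) by (intro bij_comp)
    moreover have "linear (S2 \<circ> A \<circ> T1)" using lin A(1) by (intro linear_compose)
    moreover have "(S2 \<circ> A \<circ> T1) ` C1 = C2"
    proof -
      have "(S2 \<circ> A \<circ> T1) ` C1 = S2 ` A ` T1 ` C1" by (simp add: image_image)
      also have "\<dots> = C2" unfolding A(3) by (simp add: image_image 2(3))
      finally show ?thesis .
    qed
    ultimately show ?thesis by blast
  qed
qed

end
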